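(* Let $d\geq3$ be odd and let $f:[0,4]\to(-\infty,\infty]$ be a function finite and continuous on $(0,4]$ with $f(0)=\lim_{t\to0^+}f(t)$ and with a second derivative $f''$ existing and convex on $(0,4)$. Then (i) the potential $p_f(\cdot,\overline\omega_{2d+2})$ attains its absolute minimum over $S^{d-1}$ at every point of $\overline\omega_{\kappa(d)}$; (ii) the potential $p_f(\cdot,\overline\omega_{\kappa(d)})$ attains its absolute minimum over $S^{d-1}$ at every point of $\overline\omega_{2d+2}$. If $f''$ is strictly convex on $(0,4)$, then $p_f(\cdot,\overline\omega_{2d+2})$ has no other points of absolute minimum on $S^{d-1}$ than those of $\overline\omega_{\kappa(d)}$, and $p_f(\cdot,\overline\omega_{\kappa(d)})$ has no other points of absolute minimum on $S^{d-1}$ than those of $\overline\omega_{2d+2}$.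
   Context: $S^{d-1}$ is the unit sphere in $\mathbb R^d$. For a finite configuration $\omega=\{\mathbf x_1,\dots,\mathbf x_N\}\subset S^{d-1}$, $p_f(\mathbf x,\omega)=\sum_{i=1}^N f(|\mathbf x-\mathbf x_i|^2)$. Let $\mathbf x_0,\mathbf x_1,\dots,\mathbf x_d$ be the vertices of a regular $d$-simplex inscribed in $S^{d-1}$ (so $\mathbf x_i\cdot\mathbf x_j=-1/d$ for $i\ne j$ and $\sum_i\mathbf x_i=\mathbf 0$). Set $\overline\omega_{2d+2}=\{\pm\mathbf x_i: i=0,\dots,d\}$, $\kappa(d)=\binom{d+1}{(d+1)/2}$, and $$\overline\omega_{\kappa(d)}=\Big\{\tfrac{2\sqrt d}{d+1}\sum_{i\in I}\mathbf x_i:\ I\subset\{0,1,\dots,d\},\ \#I=\tfrac{d+1}{2}\Big\}\subset S^{d-1}.$$ *)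

theory Defs
  imports "HOL-Analysis.Analysis"
begin

text \<open>Regularity of a simplex means that all its edges have the same length. The vertices are
  \<open>x 0, \<dots>, x d\<close>.\<close>

definition inscribed_regular_simplex :: "nat \<Rightarrow> (nat \<Rightarrow> 'a::euclidean_space) \<Rightarrow> bool" where
  "inscribed_regular_simplex d x \<longleftrightarrow>
     inj_on x {..d} \<and> \<not> affine_dependent (x ` {..d}) \<and>
     (\<exists>s. \<forall>i\<le>d. \<forall>j\<le>d. i \<noteq> j \<longrightarrow> dist (x i) (x j) = s) \<and>
     x ` {..d} \<subseteq> sphere 0 1"

definition potential :: "(real \<Rightarrow> ereal) \<Rightarrow> 'a::euclidean_space set \<Rightarrow> 'a \<Rightarrow> ereal" where
  "potential f \<omega> x = (\<Sum>y\<in>\<omega>. f ((norm (x - y))\<^sup>2))"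

definition antipodal_config :: "nat \<Rightarrow> (nat \<Rightarrow> 'a::euclidean_space) \<Rightarrow> 'a set" where
  "antipodal_config d x = x ` {..d} \<union> (\<lambda>i. - x i) ` {..d}"

text \<open>Meant for odd \<open>d\<close>, where \<open>(d + 1) div 2\<close> is the exact half.\<close>

definition half_sum_config :: "nat \<Rightarrow> (nat \<Rightarrow> 'a::euclidean_space) \<Rightarrow> 'a set" where
  "half_sum_config d x =
     {(2 * sqrt (real d) / (real d + 1)) *\<^sub>R (\<Sum>i\<in>I. x i) | I. I \<subseteq> {..d} \<and> card I = (d + 1) div 2}"

definition strictly_convex_on :: "real set \<Rightarrow> (real \<Rightarrow> real) \<Rightarrow> bool" where
  "strictly_convex_on S g \<longleftrightarrow> convex S \<and>
     (\<forall>u v x y. 0 < u \<longrightarrow> 0 < v \<longrightarrow> u + v = 1 \<longrightarrow> x \<in> S \<longrightarrow> y \<in> S \<longrightarrow> x \<noteq> y \<longrightarrow>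
        g (u * x + v * y) < u * g x + v * g y)"

text \<open>Derivatives of an extended-real-valued function; they are only meaningful on open sets where
  the function is finite, since \<open>real_of_ereal\<close> sends infinite values to 0.\<close>

definition twice_differentiable_on :: "(real \<Rightarrow> ereal) \<Rightarrow> real set \<Rightarrow> bool" where
  "twice_differentiable_on f S \<longleftrightarrow>
     (\<forall>t\<in>S. (\<lambda>s. real_of_ereal (f s)) differentiable (at t) \<and>
            deriv (\<lambda>s. real_of_ereal (f s)) differentiable (at t))"

definition second_deriv :: "(real \<Rightarrow> ereal) \<Rightarrow> real \<Rightarrow> real" where
  "second_deriv f = deriv (deriv (\<lambda>s. real_of_ereal (f s)))"

text \<open>In full dimension the centre of a regular simplex inscribed in the unit sphere is
  automatically the origin.\<close>

lemma inscribed_regular_simplex_iff: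
  fixes x :: "nat \<Rightarrow> 'a::euclidean_space"
  assumes d: "DIM('a) = d"
  shows "inscribed_regular_simplex d x \<longleftrightarrow>
    (\<forall>i\<le>d. norm (x i) = 1) \<and> (\<forall>i\<le>d. \<forall>j\<le>d. i \<noteq> j \<longrightarrow> x i \<bullet> x j = - 1 / real d) \<and>
    (\<Sum>i\<le>d. x i) = 0"
proof -
  have dpos: "d \<ge> 1" using d DIM_positive[where 'a='a] by linarith
  show ?thesis
  proof (intro iffI)
    assume L: "inscribed_regular_simplex d x"
    then obtain s where inj: "inj_on x {..d}"
      and s: "\<And>i j. i \<le> d \<Longrightarrow> j \<le> d \<Longrightarrow> i \<noteq> j \<Longrightarrow> dist (x i) (x j) = s"
      and nrm: "\<And>i. i \<le> d \<Longrightarrow> norm (x i) = 1"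
      unfolding inscribed_regular_simplex_def by (auto simp: image_subset_iff)
    define c where "c = 1 - s\<^sup>2 / 2"
    have ip: "x i \<bullet> x j = c" if "i \<le> d" "j \<le> d" "i \<noteq> j" for i j
    proof -
      have "s\<^sup>2 = (norm (x i - x j))\<^sup>2" using s[OF that] by (simp add: dist_norm)
      also have "\<dots> = 2 - 2 * (x i \<bullet> x j)"
        using nrm[OF that(1)] nrm[OF that(2)]
        by (simp add: power2_norm_eq_inner inner_diff_left inner_diff_right inner_commute norm_eq_1)
      finally show ?thesis by (simp add: c_def diff_divide_distrib)
    qed
    have "x 0 \<noteq> x 1" using inj_onD[OF inj, of 0 1] dpos by auto
    moreover have "dist (x 0) (x 1) = s" by (rule s) (use dpos in auto)
    ultimately have "s \<noteq> 0" by auto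
    then have c1: "c < 1" by (simp add: c_def)
    have "card (x ` {..d}) = d + 1" using inj by (simp add: card_image)
    then have "dependent (x ` {..d})" using d by (intro dependent_biggerset) auto
    then obtain u v where v: "v \<in> x ` {..d}" "u v \<noteq> 0" and u: "(\<Sum>v\<in>x ` {..d}. u v *\<^sub>R v) = 0"
      by (auto simp: dependent_finite)
    define a where "a = u \<circ> x"
    have a0: "(\<Sum>i\<le>d. a i *\<^sub>R x i) = 0"
      using u inj by (simp add: sum.reindex a_def)
    define A where "A = (\<Sum>i\<le>d. a i)"
    have aj: "a j * (1 - c) = - c * A" if j: "j \<le> d" for j
    proof -
      have "0 = (\<Sum>i\<le>d. a i *\<^sub>R x i) \<bullet> x j" using a0 by simp
      also have "\<dots> = (\<Sum>i\<le>d. a i * (x i \<bullet> x j))" by (simp add: inner_sum_left)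
      also have "\<dots> = (\<Sum>i\<le>d. c * a i + (if i = j then (1 - c) * a i else 0))"
        using ip j nrm by (intro sum.cong) (auto simp: norm_eq_1 algebra_simps)
      also have "\<dots> = c * A + (1 - c) * a j"
        using j by (simp add: sum.distrib A_def sum_distrib_left)
      finally show ?thesis by (simp add: algebra_simps)
    qed
    define b where "b = - c * A / (1 - c)"
    have ab: "a j = b" if "j \<le> d" for j using aj[OF that] c1 by (simp add: b_def field_simps)
    have "b \<noteq> 0" using v ab by (auto simp: a_def)
    moreover have "b *\<^sub>R (\<Sum>i\<le>d. x i) = 0" using a0 ab by (simp add: scaleR_sum_right)
    ultimately have sum0: "(\<Sum>i\<le>d. x i) = 0" by simp
    have "0 = (\<Sum>i\<le>d. x i) \<bullet> x 0" using sum0 by simp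
    also have "\<dots> = (\<Sum>i\<le>d. c + (if i = 0 then 1 - c else 0))"
      unfolding inner_sum_left using ip nrm by (intro sum.cong) (auto simp: norm_eq_1)
    also have "\<dots> = real d * c + 1" by (simp add: sum.distrib algebra_simps)
    finally have "c = - 1 / real d" using dpos by (simp add: field_simps)
    then show "(\<forall>i\<le>d. norm (x i) = 1) \<and> (\<forall>i\<le>d. \<forall>j\<le>d. i \<noteq> j \<longrightarrow> x i \<bullet> x j = - 1 / real d) \<and>
      (\<Sum>i\<le>d. x i) = 0" using nrm ip sum0 by auto
  next
    assume R: "(\<forall>i\<le>d. norm (x i) = 1) \<and> (\<forall>i\<le>d. \<forall>j\<le>d. i \<noteq> j \<longrightarrow> x i \<bullet> x j = - 1 / real d) \<and>
      (\<Sum>i\<le>d. x i) = 0"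
    then have nrm: "\<And>i. i \<le> d \<Longrightarrow> x i \<bullet> x i = 1" 
      and ip: "\<And>i j. i \<le> d \<Longrightarrow> j \<le> d \<Longrightarrow> i \<noteq> j \<Longrightarrow> x i \<bullet> x j = - 1 / real d"
      by (auto simp: norm_eq_1)
    have inj: "inj_on x {..d}"
    proof (rule inj_onI, rule ccontr)
      fix i j assume ij: "i \<in> {..d}" "j \<in> {..d}" "x i = x j" "i \<noteq> j"
      then have "1 = - 1 / real d" using nrm[of i] ip[of i j] by auto
      then show False using dpos by (simp add: field_simps)
    qed
    have ds: "dist (x i) (x j) = sqrt (2 + 2 / real d)" if "i \<le> d" "j \<le> d" "i \<noteq> j" for i j
      using nrm[OF that(1)] nrm[OF that(2)] ip[OF that] 
      by (simp add: dist_norm norm_eq_sqrt_inner inner_diff_left inner_diff_right inner_commute)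
    have "\<not> affine_dependent (x ` {..d})"
    proof
      assume "affine_dependent (x ` {..d})"
      then obtain u where u0: "sum u (x ` {..d}) = 0" and v: "\<exists>v\<in>x ` {..d}. u v \<noteq> 0"
        and us: "(\<Sum>v\<in>x ` {..d}. u v *\<^sub>R v) = 0"
        by (auto simp: affine_dependent_explicit_finite)
      define a where "a = u \<circ> x"
      have a0: "(\<Sum>i\<le>d. a i *\<^sub>R x i) = 0" "(\<Sum>i\<le>d. a i) = 0"
        using us u0 inj by (simp_all add: sum.reindex a_def)
      have "a j = 0" if j: "j \<le> d" for j
      proof -
        have "0 = (\<Sum>i\<le>d. a i *\<^sub>R x i) \<bullet> x j" using a0 by simp
        also have "\<dots> = (\<Sum>i\<le>d. a i * (x i \<bullet> x j))" by (simp add: inner_sum_left)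
        also have "\<dots> = (\<Sum>i\<le>d. (- 1 / real d) * a i + (if i = j then (1 + 1 / real d) * a i else 0))"
          using ip j nrm by (intro sum.cong) (auto simp: algebra_simps)
        also have "\<dots> = (- 1 / real d) * (\<Sum>i\<le>d. a i) + (1 + 1 / real d) * a j"
          using j by (simp only: sum.distrib sum_distrib_left) simp
        finally have "(1 + 1 / real d) * a j = 0" using a0 by simp
        moreover have "1 + 1 / real d > 0" by (simp add: add_pos_nonneg)
        ultimately show ?thesis by simp
      qed
      then show False using v by (auto simp: a_def)
    qed
    then show "inscribed_regular_simplex d x"
      unfolding inscribed_regular_simplex_def using inj ds R by (auto simp: image_subset_iff)
  qed
qed

end

theory Submission
  imports Defs
begin

text \<open>Both configurations are antipodal, so twice the potential at \<open>z\<close> is the sum over \<open>y\<close> of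
  \<open>H (z \<bullet> y)\<close> with \<open>H t = f (2 - 2 t) + f (2 + 2 t)\<close>. As \<open>f''\<close> is convex, \<open>H''\<close> is even and
  convex, hence nondecreasing on \<open>[0, 1)\<close>; with \<open>H' 0 = 0\<close> this makes \<open>H' t / t\<close>
  nondecreasing, that is, \<open>H\<close> is a convex function of \<open>t\<^sup>2\<close>. Its tangent at
  \<open>t\<^sup>2 = 1 / d\<close> gives a bound \<open>a + b t\<^sup>2 \<le> H t\<close>. For both configurations the sum of
  \<open>(z \<bullet> y)\<^sup>2\<close> is constant on the sphere, so the bound sums to a constant, which is attained when
  every \<open>\<bar>z \<bullet> y\<bar>\<close> is \<open>1 / sqrt d\<close>. All inner products between the two configurations have
  this absolute value. In the strict case it remains to see that no other \<open>z\<close> has this property.\<close>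

section \<open>Quadratic minorant of the symmetrized pair potential\<close>

lemma has_real_derivative_reflected:
  fixes G :: "real \<Rightarrow> real"
  assumes "\<And>s. 0 < s \<Longrightarrow> s < 4 \<Longrightarrow> (G has_real_derivative G' s) (at s)" "-1 < t" "t < 1"
  shows "((\<lambda>t. G (2 + 2 * t)) has_real_derivative 2 * G' (2 + 2 * t)) (at t)"
    and "((\<lambda>t. G (2 - 2 * t)) has_real_derivative - 2 * G' (2 - 2 * t)) (at t)"
proof -
  have "((\<lambda>t. G (2 + 2 * t)) has_real_derivative G' (2 + 2 * t) * 2) (at t)"
    using assms by (intro DERIV_chain2[where f = G]) (auto intro!: derivative_eq_intros)
  then show "((\<lambda>t. G (2 + 2 * t)) has_real_derivative 2 * G' (2 + 2 * t)) (at t)"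
    by (simp add: mult.commute)
  have "((\<lambda>t. G (2 - 2 * t)) has_real_derivative G' (2 - 2 * t) * (- 2)) (at t)"
    using assms by (intro DERIV_chain2[where f = G]) (auto intro!: derivative_eq_intros)
  then show "((\<lambda>t. G (2 - 2 * t)) has_real_derivative - 2 * G' (2 - 2 * t)) (at t)"
    by (simp add: mult.commute)
qed

text \<open>The coefficient \<open>H' c / (2 * c)\<close> is the derivative of the pair sum with
  respect to \<open>t\<^sup>2\<close> at \<open>t = c\<close>. The derivative of
  \<open>\<phi> c\<close> is \<open>t * (H' t / t - H' c / c)\<close>, and \<open>H' t / t\<close>
  is nondecreasing, so this is at most 0 before \<open>c\<close> and at least 0 after it. With
  \<open>t < 1\<close> all arguments of \<open>F\<close> stay inside the open interval.\<close>

lemma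
  fixes F F' F'' :: "real \<Rightarrow> real"
  defines "H' \<equiv> \<lambda>t. 2 * (F' (2 + 2 * t) - F' (2 - 2 * t))"
  defines "\<phi> \<equiv> \<lambda>c t. F (2 - 2 * t) + F (2 + 2 * t) - H' c / (2 * c) * t\<^sup>2"
  assumes F: "\<And>s. 0 < s \<Longrightarrow> s < 4 \<Longrightarrow> (F has_real_derivative F' s) (at s)"
    and F': "\<And>s. 0 < s \<Longrightarrow> s < 4 \<Longrightarrow> (F' has_real_derivative F'' s) (at s)"
    and conv: "convex_on {0<..<4} F''"
    and c: "0 < c" "c < 1"
  shows symmetrization_minus_quadratic_decreasing:
      "\<lbrakk>0 \<le> s; s < t; t \<le> c\<rbrakk> \<Longrightarrow> \<phi> c t \<le> \<phi> c s \<and> (strictly_convex_on {0<..<4} F'' \<longrightarrow> \<phi> c t < \<phi> c s)"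
    and symmetrization_minus_quadratic_increasing:
      "\<lbrakk>c \<le> s; s < t; t < 1\<rbrakk> \<Longrightarrow> \<phi> c s \<le> \<phi> c t \<and> (strictly_convex_on {0<..<4} F'' \<longrightarrow> \<phi> c s < \<phi> c t)"
proof -
  let ?S = "strictly_convex_on {0<..<4} F''"
  define H'' where "H'' t = 4 * (F'' (2 + 2 * t) + F'' (2 - 2 * t))" for t
  have H': "(H' has_real_derivative H'' t) (at t)" if "-1 < t" "t < 1" for t
    unfolding H'_def H''_def
    using that by (auto intro!: derivative_eq_intros has_real_derivative_reflected[of F' F''] F')
  have H''_mono: "H'' s \<le> H'' t \<and> (?S \<longrightarrow> H'' s < H'' t)" if st: "0 \<le> s" "s < t" "t < 1" for s t
  proof -
    \<comment> \<open>The weights write \<open>2 + 2 * s\<close> as a convex combination of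
      \<open>2 + 2 * t\<close> and \<open>2 - 2 * t\<close>; interchanging them gives the mirror
      point \<open>2 - 2 * s\<close>. Adding the two convexity inequalities cancels the
      weights.\<close>
    define u where "u = (t + s) / (2 * t)"
    define v where "v = (t - s) / (2 * t)"
    have uv: "u > 0" "v > 0" "u + v = 1" using st by (simp_all add: u_def v_def field_simps)
    have e: "2 + 2 * s = u * (2 + 2 * t) + v * (2 - 2 * t)" "2 - 2 * s = v * (2 + 2 * t) + u * (2 - 2 * t)"
      using st by (simp_all add: u_def v_def field_simps)
    have "F'' (2 + 2 * s) \<le> u * F'' (2 + 2 * t) + v * F'' (2 - 2 * t)"
      "F'' (2 - 2 * s) \<le> v * F'' (2 + 2 * t) + u * F'' (2 - 2 * t)"
      unfolding e using conv uv st by (auto simp: convex_on_def)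
    moreover have "F'' (2 + 2 * s) < u * F'' (2 + 2 * t) + v * F'' (2 - 2 * t)"
      "F'' (2 - 2 * s) < v * F'' (2 + 2 * t) + u * F'' (2 - 2 * t)" if ?S
      unfolding e using that uv st by (auto simp: strictly_convex_on_def)
    moreover have "v * F'' (2 + 2 * t) + u * F'' (2 - 2 * t) + (u * F'' (2 + 2 * t) + v * F'' (2 - 2 * t))
        = F'' (2 + 2 * t) + F'' (2 - 2 * t)"
      using arg_cong[OF uv(3), of "\<lambda>w. w * (F'' (2 + 2 * t) + F'' (2 - 2 * t))"] by (simp add: algebra_simps)
    ultimately show ?thesis by (auto simp: H''_def)
  qed
  have slope: "H' s / s \<le> H' t / t \<and> (?S \<longrightarrow> H' s / s < H' t / t)" if st: "0 < s" "s < t" "t < 1" for s t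
  proof -
    \<comment> \<open>\<open>H'' p\<close> and \<open>H'' q\<close> are the mean slopes of
      \<open>H'\<close> on \<open>{0..s}\<close> and \<open>{s..t}\<close>. As
      \<open>H' 0 = 0\<close>, the quotient \<open>H' t / t\<close> is a weighted average of the
      two, while \<open>H' s / s\<close> is the first alone.\<close>
    obtain p where p: "0 < p" "p < s" "H' s - H' 0 = (s - 0) * H'' p"
      using MVT2[of 0 s H' H''] H' st by force
    obtain q where q: "s < q" "q < t" "H' t - H' s = (t - s) * H'' q"
      using MVT2[of s t H' H''] H' st by force
    have "H' 0 = 0" by (simp add: H'_def)
    then have 1: "H' s = s * H'' p" "H' t = s * H'' p + (t - s) * H'' q" using p q by simp_all
    have "H' t / t - H' s / s = (t - s) / t * (H'' q - H'' p)"
      unfolding 1 using st by (simp add: field_simps)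
    moreover have "(t - s) / t > 0" using st by simp
    moreover have "H'' p \<le> H'' q \<and> (?S \<longrightarrow> H'' p < H'' q)" using H''_mono p q st by auto
    ultimately show ?thesis
      by (metis diff_ge_0_iff_ge diff_gt_0_iff_gt less_imp_le mult_nonneg_nonneg mult_pos_pos)
  qed
  have \<phi>: "(\<phi> c has_real_derivative t * (H' t / t - H' c / c)) (at t)" if "0 < t" "t < 1" for t
  proof -
    have "(\<phi> c has_real_derivative H' t - H' c / c * t) (at t)"
      unfolding \<phi>_def
      using that c by (auto intro!: derivative_eq_intros has_real_derivative_reflected[of F F'] F
          simp: H'_def divide_simps)
    moreover have "H' t - H' c / c * t = t * (H' t / t - H' c / c)" using that by (simp add: right_diff_distrib)
    ultimately show ?thesis by simp
  qed
  have \<phi>_cont: "isCont (\<phi> c) t" if "-1 < t" "t < 1" for t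
  proof -
    have "isCont (\<lambda>t. F (2 - 2 * t)) t" "isCont (\<lambda>t. F (2 + 2 * t)) t"
      using has_real_derivative_reflected[of F F' t] F that by (auto intro: DERIV_isCont)
    then show ?thesis unfolding \<phi>_def by (intro continuous_intros)
  qed
  have \<phi>_MVT: "\<exists>q. s < q \<and> q < t \<and> \<phi> c t - \<phi> c s = (t - s) * (q * (H' q / q - H' c / c))"
    if "0 \<le> s" "s < t" "t < 1" for s t
  proof -
    have "continuous_on {s..t} (\<phi> c)"
      using that by (intro continuous_at_imp_continuous_on ballI \<phi>_cont) auto
    moreover have "\<phi> c differentiable (at q)" if "s < q" "q < t" for q
      using \<phi>[of q] that \<open>0 \<le> s\<close> \<open>t < 1\<close> by (auto simp: real_differentiable_def)
    ultimately obtain l q where "s < q" "q < t" "(\<phi> c has_real_derivative l) (at q)"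
      "\<phi> c t - \<phi> c s = (t - s) * l"
      using MVT[OF \<open>s < t\<close>] by blast
    moreover from this have "l = q * (H' q / q - H' c / c)"
      using that by (intro DERIV_unique[OF _ \<phi>]) auto
    ultimately show ?thesis by blast
  qed
  show "\<phi> c t \<le> \<phi> c s \<and> (?S \<longrightarrow> \<phi> c t < \<phi> c s)" if st: "0 \<le> s" "s < t" "t \<le> c"
  proof -
    obtain q where q: "s < q" "q < t" "\<phi> c t - \<phi> c s = (t - s) * (q * (H' q / q - H' c / c))"
      using \<phi>_MVT[of s t] st c by auto
    have "(t - s) * q > 0" using st q by simp
    then show ?thesis using slope[of q c] q st c
      by (smt (verit, best) mult.assoc mult_nonneg_nonpos mult_pos_neg)
  qed
  show "\<phi> c s \<le> \<phi> c t \<and> (?S \<longrightarrow> \<phi> c s < \<phi> c t)" if st: "c \<le> s" "s < t" "t < 1"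
  proof -
    obtain q where q: "s < q" "q < t" "\<phi> c t - \<phi> c s = (t - s) * (q * (H' q / q - H' c / c))"
      using \<phi>_MVT[of s t] st c by auto
    have "(t - s) * q > 0" using st q c by simp
    then show ?thesis using slope[of c q] q st c
      by (smt (verit, best) mult.assoc mult_nonneg_nonneg mult_pos_pos)
  qed
qed

text \<open>The minorant is the tangent, in the variable \<open>t\<^sup>2\<close>, at
  \<open>c\<^sup>2\<close>. Monotonicity on both sides of \<open>c\<close> gives the bound for
  \<open>\<bar>t\<bar> < 1\<close>; the endpoints need a limit because \<open>f 0\<close> may be
  infinite.\<close>

lemma pair_potential_minorant:
  fixes f :: "real \<Rightarrow> ereal" and c :: real
  assumes f_range: "\<forall>t\<in>{0..4}. f t \<noteq> -\<infinity>"
    and f_finite: "\<forall>t\<in>{0<..4}. f t \<noteq> \<infinity>"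
    and f_cont: "continuous_on {0<..4} f"
    and f_zero: "(f \<longlongrightarrow> f 0) (at_right 0)"
    and f_diff: "twice_differentiable_on f {0<..<4}"
    and f_convex: "convex_on {0<..<4} (second_deriv f)"
    and c: "0 < c" "c < 1"
  obtains a b :: real where
    "\<And>t. \<bar>t\<bar> \<le> 1 \<Longrightarrow> ereal (a + b * t\<^sup>2) \<le> f (2 - 2 * t) + f (2 + 2 * t)"
    "\<And>t. \<bar>t\<bar> = c \<Longrightarrow> f (2 - 2 * t) + f (2 + 2 * t) = ereal (a + b * t\<^sup>2)"
    "\<And>t. \<lbrakk>strictly_convex_on {0<..<4} (second_deriv f); \<bar>t\<bar> \<le> 1;
           f (2 - 2 * t) + f (2 + 2 * t) = ereal (a + b * t\<^sup>2)\<rbrakk> \<Longrightarrow> \<bar>t\<bar> = c"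
proof -
  let ?S = "strictly_convex_on {0<..<4} (second_deriv f)"
  define F where "F s = real_of_ereal (f s)" for s
  define b where "b = 2 * (deriv F (2 + 2 * c) - deriv F (2 - 2 * c)) / (2 * c)"
  define \<phi> where "\<phi> t = F (2 - 2 * t) + F (2 + 2 * t) - b * t\<^sup>2" for t
  define G where "G t = f (2 - 2 * t) + f (2 + 2 * t)" for t
  have f_eq: "f s = ereal (F s)" if "0 < s" "s \<le> 4" for s
    using that f_range f_finite by (cases "f s") (auto simp: F_def)
  have G_eq: "G t = ereal (\<phi> t + b * t\<^sup>2)" if "-1 < t" "t < 1" for t
    using that by (simp add: G_def \<phi>_def f_eq)
  have F: "(F has_real_derivative deriv F s) (at s)"
    and F': "(deriv F has_real_derivative second_deriv f s) (at s)" if "0 < s" "s < 4" for s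
    using f_diff that
    by (auto simp: twice_differentiable_on_def second_deriv_def F_def[abs_def] DERIV_deriv_iff_real_differentiable)
  have left: "\<phi> t \<le> \<phi> s \<and> (?S \<longrightarrow> \<phi> t < \<phi> s)" if "0 \<le> s" "s < t" "t \<le> c" for s t
    unfolding \<phi>_def b_def by (rule symmetrization_minus_quadratic_decreasing[OF F F' f_convex c that])
  have right: "\<phi> s \<le> \<phi> t \<and> (?S \<longrightarrow> \<phi> s < \<phi> t)" if "c \<le> s" "s < t" "t < 1" for s t
    unfolding \<phi>_def b_def by (rule symmetrization_minus_quadratic_increasing[OF F F' f_convex c that])
  \<comment> \<open>The bound at 1 is proved with \<open>\<phi> r\<close> for some
    \<open>r > c\<close> instead of \<open>\<phi> c\<close>, since a strict inequality would not
    survive the limit. The limit of the sum exists in the extended reals because \<open>f 4\<close>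
    is finite.\<close>
  have endpoint: "ereal (\<phi> r + b) \<le> G 1" if r: "c < r" "r < 1" for r
  proof (rule tendsto_le)
    show "((\<lambda>t. ereal (\<phi> r + b * t\<^sup>2)) \<longlongrightarrow> ereal (\<phi> r + b)) (at_left 1)"
      by (intro tendsto_intros tendsto_eq_intros) (auto intro!: tendsto_eq_intros)
    have "((\<lambda>t. f (2 - 2 * t)) \<longlongrightarrow> f 0) (at_left 1)"
      by (rule filterlim_compose[OF f_zero])
        (auto simp: filterlim_at eventually_at_filter intro!: tendsto_eq_intros)
    moreover have "((\<lambda>t. f (2 + 2 * t)) \<longlongrightarrow> f 4) (at_left 1)"
    proof (rule filterlim_compose[where g = f])
      show "(f \<longlongrightarrow> f 4) (at 4 within {0<..4})" using f_cont by (auto simp: continuous_on)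
      have "\<forall>\<^sub>F t in at_left (1::real). t \<in> {0<..<1}" by (rule eventually_at_left_real) simp
      then have "\<forall>\<^sub>F t in at_left (1::real). 2 + 2 * t \<in> {0<..4} \<and> 2 + 2 * t \<noteq> 4"
        by (rule eventually_mono) auto
      then show "filterlim (\<lambda>t. 2 + 2 * t) (at 4 within {0<..4}) (at_left (1::real))"
        by (auto simp: filterlim_at intro!: tendsto_eq_intros)
    qed
    ultimately have "((\<lambda>t. f (2 - 2 * t) + f (2 + 2 * t)) \<longlongrightarrow> f 0 + f 4) (at_left 1)"
      by (intro tendsto_add_ereal_general1) (auto simp: f_eq)
    then show "(G \<longlongrightarrow> G 1) (at_left 1)" by (simp add: G_def[abs_def])
    have "\<forall>\<^sub>F t in at_left 1. t \<in> {r<..<1}" using r by (intro eventually_at_left_real)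
    then show "\<forall>\<^sub>F t in at_left 1. ereal (\<phi> r + b * t\<^sup>2) \<le> G t"
      by (rule eventually_mono) (use right[of r] r c in \<open>auto simp: G_eq\<close>)
  qed simp
  have pos: "ereal (\<phi> c + b * t\<^sup>2) \<le> G t \<and> (?S \<longrightarrow> t \<noteq> c \<longrightarrow> ereal (\<phi> c + b * t\<^sup>2) < G t)"
    if t: "0 \<le> t" "t \<le> 1" for t
  proof (cases "t = 1")
    case True
    \<comment> \<open>Any point strictly between \<open>c\<close> and 1 serves; the strict increase
      from \<open>\<phi> c\<close> to \<open>\<phi> r\<close> supplies strictness at 1.\<close>
    define r where "r = (1 + c) / 2"
    have r: "c < r" "r < 1" using c by (auto simp: r_def)
    have "ereal (\<phi> c + b) \<le> ereal (\<phi> r + b) \<and> (?S \<longrightarrow> ereal (\<phi> c + b) < ereal (\<phi> r + b))"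
      using right[of c r] r by simp
    then have "ereal (\<phi> c + b) \<le> G 1 \<and> (?S \<longrightarrow> ereal (\<phi> c + b) < G 1)"
      using endpoint[OF r] order_trans less_le_trans by blast
    then show ?thesis using True by simp
  next
    case False
    then show ?thesis using t left[of t c] right[of c t] c by (cases t c rule: linorder_cases) (auto simp: G_eq)
  qed
  have G_abs: "G \<bar>t\<bar> = G t" for t
    by (cases "t \<ge> 0") (auto simp: G_def add.commute)
  show thesis
  proof (rule that[of "\<phi> c" b, folded G_def])
    show "ereal (\<phi> c + b * t\<^sup>2) \<le> G t" if "\<bar>t\<bar> \<le> 1" for t
      using pos[of "\<bar>t\<bar>"] that by (simp add: G_abs)
    show "G t = ereal (\<phi> c + b * t\<^sup>2)" if "\<bar>t\<bar> = c" for t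
      using G_eq[of c] G_abs[of t] that c by auto
    show "\<bar>t\<bar> = c" if ?S "\<bar>t\<bar> \<le> 1" "G t = ereal (\<phi> c + b * t\<^sup>2)" for t
      using pos[of "\<bar>t\<bar>"] that by (auto simp: G_abs)
  qed
qed

section \<open>From the pair bound to a bound for potentials\<close>

text \<open>A finite total rules out infinite summands, so the difference can be taken in the reals,
  where nonnegative terms with sum zero vanish.\<close>

lemma sum_ereal_eq_imp_eq:
  fixes g :: "'b \<Rightarrow> ereal" and r :: "'b \<Rightarrow> real"
  assumes fin: "finite Y" and le: "\<And>y. y \<in> Y \<Longrightarrow> ereal (r y) \<le> g y"
    and eq: "(\<Sum>y\<in>Y. g y) = ereal (\<Sum>y\<in>Y. r y)" and y: "y \<in> Y"
  shows "g y = ereal (r y)"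
proof -
  have "(\<Sum>y\<in>Y. g y) \<noteq> \<infinity>" by (simp add: eq)
  then have fin_g: "g y = ereal (real_of_ereal (g y))" if "y \<in> Y" for y
    using that le[OF that] fin by (cases "g y") (auto simp: sum_Pinfty)
  have "ereal (\<Sum>y\<in>Y. real_of_ereal (g y)) = (\<Sum>y\<in>Y. g y)"
    unfolding sum_ereal[symmetric] by (rule sum.cong) (simp_all flip: fin_g)
  then have "(\<Sum>y\<in>Y. real_of_ereal (g y) - r y) = 0" by (simp add: eq sum_subtractf)
  moreover have "real_of_ereal (g y) - r y \<ge> 0" if "y \<in> Y" for y
    using le[OF that] fin_g[OF that] by (metis diff_ge_0_iff_ge ereal_less_eq(3))
  ultimately have "real_of_ereal (g y) - r y = 0"
    using fin y by (simp add: sum_nonneg_eq_0_iff)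
  then show ?thesis using fin_g[OF y] by simp
qed

text \<open>For unit vectors the squared distance is \<open>2 - 2 * (z \<bullet> y)\<close>, and
  replacing \<open>y\<close> by \<open>- y\<close> changes the sign of the inner product. Doubling
  avoids a division in the extended reals.\<close>

lemma potential_symmetric:
  fixes Y :: "'a::euclidean_space set"
  assumes "uminus ` Y = Y" "Y \<subseteq> sphere 0 1" "z \<in> sphere 0 1"
  shows "potential f Y z + potential f Y z = (\<Sum>y\<in>Y. f (2 - 2 * (z \<bullet> y)) + f (2 + 2 * (z \<bullet> y)))"
proof -
  have n: "(norm (z - y))\<^sup>2 = 2 - 2 * (z \<bullet> y)" if "norm y = 1" for y
    using that assms(3)
    by (simp add: power2_norm_eq_inner inner_diff_left inner_diff_right inner_commute norm_eq_1)
  have 1: "potential f Y z = (\<Sum>y\<in>Y. f (2 - 2 * (z \<bullet> y)))"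
    unfolding potential_def using assms(2) by (intro sum.cong) (auto simp: n)
  also have "\<dots> = (\<Sum>y\<in>uminus ` Y. f (2 - 2 * (z \<bullet> y)))" by (simp add: assms(1))
  also have "\<dots> = (\<Sum>y\<in>Y. f (2 + 2 * (z \<bullet> y)))" by (simp add: sum.reindex)
  finally have 2: "potential f Y z = (\<Sum>y\<in>Y. f (2 + 2 * (z \<bullet> y)))" .
  show ?thesis by (subst 1, subst 2) (simp add: sum.distrib)
qed

text \<open>Summing the minorant over \<open>Y\<close> bounds twice the potential by a quantity that
  \<open>design\<close> makes independent of the point. Equality at \<open>z\<close> makes the bound
  the minimum, so every minimizer \<open>w\<close> must have equality in each summand. In the second
  lemma \<open>z\<close> is the witness that the bound is attained.\<close>

lemma
  fixes Y :: "'a::euclidean_space set"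
  assumes Y: "finite Y" "uminus ` Y = Y" "Y \<subseteq> sphere 0 1"
    and design: "\<And>z. z \<in> sphere 0 1 \<Longrightarrow> (\<Sum>y\<in>Y. (z \<bullet> y)\<^sup>2) = K"
    and le: "\<And>t. \<bar>t\<bar> \<le> 1 \<Longrightarrow> ereal (a + b * t\<^sup>2) \<le> f (2 - 2 * t) + f (2 + 2 * t)"
    and eq: "\<And>t. \<bar>t\<bar> = c \<Longrightarrow> f (2 - 2 * t) + f (2 + 2 * t) = ereal (a + b * t\<^sup>2)"
    and z: "z \<in> sphere 0 1" "\<And>y. y \<in> Y \<Longrightarrow> \<bar>z \<bullet> y\<bar> = c"
  shows is_arg_min_potential: "is_arg_min (potential f Y) (\<lambda>y. y \<in> sphere 0 1) z"
    and is_arg_min_potentialD: "\<lbrakk>\<And>t. \<lbrakk>\<bar>t\<bar> \<le> 1; f (2 - 2 * t) + f (2 + 2 * t) = ereal (a + b * t\<^sup>2)\<rbrakk> \<Longrightarrow> \<bar>t\<bar> = c;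
       is_arg_min (potential f Y) (\<lambda>y. y \<in> sphere 0 1) w; y \<in> Y\<rbrakk> \<Longrightarrow> \<bar>w \<bullet> y\<bar> = c"
proof -
  let ?P = "potential f Y" and ?G = "\<lambda>t. f (2 - 2 * t) + f (2 + 2 * t)"
  define M where "M = a * card Y + b * K"
  have M: "(\<Sum>y\<in>Y. a + b * (w \<bullet> y)\<^sup>2) = M" if "w \<in> sphere 0 1" for w
    using design[OF that] by (simp add: sum.distrib M_def flip: sum_distrib_left)
  have inner_le: "\<bar>w \<bullet> y\<bar> \<le> 1" if "w \<in> sphere 0 1" "y \<in> Y" for w y
    using Cauchy_Schwarz_ineq2[of w y] that Y by auto
  have ge: "ereal M \<le> ?P w + ?P w" if w: "w \<in> sphere 0 1" for w
  proof -
    have "ereal M = (\<Sum>y\<in>Y. ereal (a + b * (w \<bullet> y)\<^sup>2))" by (simp add: M[OF w])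
    also have "\<dots> \<le> (\<Sum>y\<in>Y. ?G (w \<bullet> y))" by (intro sum_mono le inner_le w)
    finally show ?thesis by (simp add: potential_symmetric[OF Y(2,3) w])
  qed
  have z_eq: "?P z + ?P z = ereal M"
    using z(2) by (simp add: potential_symmetric[OF Y(2,3) z(1)] eq M[OF z(1)])
  show "is_arg_min ?P (\<lambda>y. y \<in> sphere 0 1) z"
    unfolding is_arg_min_def
  proof (intro conjI notI z(1))
    assume "\<exists>w. w \<in> sphere 0 1 \<and> ?P w < ?P z"
    then obtain w where w: "w \<in> sphere 0 1" "?P w < ?P z" by blast
    \<comment> \<open>By \<open>z_eq\<close> the value \<open>?P z\<close> is finite and equal to
      half of \<open>M\<close>, so a smaller value would contradict \<open>ge\<close>.\<close>
    then show False using ge[OF w(1)] z_eq by (cases "?P w"; cases "?P z") auto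
  qed
  show "\<bar>w \<bullet> y\<bar> = c" if tight: "\<And>t. \<lbrakk>\<bar>t\<bar> \<le> 1; ?G t = ereal (a + b * t\<^sup>2)\<rbrakk> \<Longrightarrow> \<bar>t\<bar> = c"
    and w: "is_arg_min ?P (\<lambda>y. y \<in> sphere 0 1) w" and y: "y \<in> Y"
  proof -
    have w1: "w \<in> sphere 0 1" and wz: "?P w \<le> ?P z" using w z(1) by (auto simp: is_arg_min_def not_less)
    have "?P w + ?P w \<le> ereal M" using add_mono[OF wz wz] z_eq by simp
    then have "(\<Sum>y\<in>Y. ?G (w \<bullet> y)) = ereal (\<Sum>y\<in>Y. a + b * (w \<bullet> y)\<^sup>2)"
      using ge[OF w1] by (simp add: potential_symmetric[OF Y(2,3) w1] M[OF w1])
    then have "?G (w \<bullet> y) = ereal (a + b * (w \<bullet> y)\<^sup>2)"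
      using Y(1) y by (intro sum_ereal_eq_imp_eq[of Y "\<lambda>y. a + b * (w \<bullet> y)\<^sup>2" "\<lambda>y. ?G (w \<bullet> y)"] le inner_le w1)
    then show ?thesis using tight inner_le[OF w1 y] by blast
  qed
qed

section \<open>Second moments over subsets of fixed size\<close>

text \<open>Removing \<open>S\<close> is a bijection onto the subsets of \<open>A - S\<close> of
  size \<open>m - card S\<close>.\<close>

lemma card_supersets:
  assumes "finite A" "S \<subseteq> A" "card S \<le> m"
  shows "card {I. S \<subseteq> I \<and> I \<subseteq> A \<and> card I = m} = (card A - card S) choose (m - card S)"
proof -
  have fS: "finite S" using assms finite_subset by blast
  have "bij_betw (\<lambda>I. I - S) {I. S \<subseteq> I \<and> I \<subseteq> A \<and> card I = m} {J. J \<subseteq> A - S \<and> card J = m - card S}"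
  proof (rule bij_betw_byWitness[where f' = "\<lambda>J. J \<union> S"])
    have "card (J \<union> S) = m" if "J \<subseteq> A - S" "card J = m - card S" for J
      using that assms fS by (subst card_Un_disjoint) (auto intro: finite_subset)
    then show "(\<lambda>J. J \<union> S) ` {J. J \<subseteq> A - S \<and> card J = m - card S} \<subseteq> {I. S \<subseteq> I \<and> I \<subseteq> A \<and> card I = m}"
      using assms by auto
  qed (use fS in \<open>auto simp: card_Diff_subset\<close>)
  then have "card {I. S \<subseteq> I \<and> I \<subseteq> A \<and> card I = m} = card {J. J \<subseteq> A - S \<and> card J = m - card S}"
    by (rule bij_betw_same_card)
  also have "\<dots> = (card A - card S) choose (m - card S)"
    using assms fS by (simp add: n_subsets card_Diff_subset)
  finally show ?thesis .
qed

text \<open>After expanding the square, \<open>t i * t j\<close> is counted once for each admissible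
  \<open>I\<close> containing both indices: \<open>?\<beta>\<close> times off the diagonal and
  \<open>?\<beta> + \<gamma>\<close> times on it. The \<open>?\<beta>\<close> part is a multiple of
  the squared total of \<open>t\<close>, which is zero.\<close>

lemma sum_subsets_square:
  fixes t :: "'i \<Rightarrow> real"
  assumes A: "finite A" and t: "(\<Sum>i\<in>A. t i) = 0" and m: "2 \<le> m"
  defines "\<gamma> \<equiv> real ((card A - 1) choose (m - 1)) - real ((card A - 2) choose (m - 2))"
  shows "(\<Sum>I | I \<subseteq> A \<and> card I = m. (\<Sum>i\<in>I. t i)\<^sup>2) = \<gamma> * (\<Sum>i\<in>A. (t i)\<^sup>2)"
proof -
  let ?\<I> = "{I. I \<subseteq> A \<and> card I = m}"
  let ?\<alpha> = "real ((card A - 1) choose (m - 1))" and ?\<beta> = "real ((card A - 2) choose (m - 2))"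
  have fin: "finite ?\<I>" using A by simp
  have N: "(\<Sum>I\<in>?\<I>. of_bool (i \<in> I \<and> j \<in> I)) = ?\<beta> + (if i = j then \<gamma> else 0)"
    if "i \<in> A" "j \<in> A" for i j
  proof -
    have "(\<Sum>I\<in>?\<I>. of_bool (i \<in> I \<and> j \<in> I)) = real (card {I. {i, j} \<subseteq> I \<and> I \<subseteq> A \<and> card I = m})"
      using fin by (simp add: sum.If_cases of_bool_def Int_def conj_ac)
    also have "\<dots> = ?\<beta> + (if i = j then \<gamma> else 0)"
      using that m by (subst card_supersets[OF A]) (auto simp: \<gamma>_def card_insert_if numeral_2_eq_2)
    finally show ?thesis .
  qed
  have "(\<Sum>I\<in>?\<I>. (\<Sum>i\<in>I. t i)\<^sup>2) = (\<Sum>I\<in>?\<I>. \<Sum>i\<in>A. \<Sum>j\<in>A. t i * t j * of_bool (i \<in> I \<and> j \<in> I))"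
  proof (rule sum.cong[OF refl])
    fix I assume I: "I \<in> ?\<I>"
    then have "(\<Sum>i\<in>I. t i) = (\<Sum>i\<in>A. t i * of_bool (i \<in> I))"
      using A by (simp add: sum.inter_restrict of_bool_def if_distrib Int_absorb1 cong: if_cong
        flip: sum.inter_restrict)
    then show "(\<Sum>i\<in>I. t i)\<^sup>2 = (\<Sum>i\<in>A. \<Sum>j\<in>A. t i * t j * of_bool (i \<in> I \<and> j \<in> I))"
      by (simp add: power2_eq_square sum_product of_bool_conj mult_ac)
  qed
  also have "\<dots> = (\<Sum>i\<in>A. \<Sum>j\<in>A. \<Sum>I\<in>?\<I>. t i * t j * of_bool (i \<in> I \<and> j \<in> I))"
    by (subst sum.swap, rule sum.cong[OF refl], rule sum.swap)
  also have "\<dots> = (\<Sum>i\<in>A. \<Sum>j\<in>A. t i * t j * (?\<beta> + (if i = j then \<gamma> else 0)))"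
    by (intro sum.cong refl) (simp add: N flip: sum_distrib_left)
  also have "\<dots> = (\<Sum>i\<in>A. ?\<beta> * t i * (\<Sum>j\<in>A. t j) + \<gamma> * (t i)\<^sup>2)"
  proof (rule sum.cong[OF refl])
    fix i assume i: "i \<in> A"
    have "(\<Sum>j\<in>A. t i * t j * (?\<beta> + (if i = j then \<gamma> else 0)))
        = (\<Sum>j\<in>A. ?\<beta> * t i * t j + (if i = j then \<gamma> * (t j)\<^sup>2 else 0))"
      by (intro sum.cong) (auto simp: algebra_simps power2_eq_square)
    then show "(\<Sum>j\<in>A. t i * t j * (?\<beta> + (if i = j then \<gamma> else 0)))
        = ?\<beta> * t i * (\<Sum>j\<in>A. t j) + \<gamma> * (t i)\<^sup>2"
      using A i by (simp add: sum.distrib sum_distrib_left)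
  qed
  also have "\<dots> = \<gamma> * (\<Sum>i\<in>A. (t i)\<^sup>2)"
    by (simp add: t sum_distrib_left)
  finally show ?thesis .
qed

section \<open>The simplex as a tight frame\<close>

locale inscribed_simplex =
  fixes d :: nat and x :: "nat \<Rightarrow> 'a::euclidean_space"
  assumes DIM: "DIM('a) = d" and simplex: "inscribed_regular_simplex d x"
begin

lemma d_pos: "d > 0"
  using DIM DIM_positive[where 'a = 'a] by simp

text \<open>The single formula for diagonal and off-diagonal inner products lets sums over vertices
  split into one exceptional term and a constant.\<close>

lemma norm_vertex: "i \<le> d \<Longrightarrow> norm (x i) = 1"
  and sum_vertices: "(\<Sum>i\<le>d. x i) = 0"
  and inner_vertex: "i \<le> d \<Longrightarrow> j \<le> d \<Longrightarrow> x i \<bullet> x j = (if i = j then 1 + 1 / real d else 0) - 1 / real d"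
  using simplex inscribed_regular_simplex_iff[OF DIM, of x] by (auto simp: norm_eq_1)

lemma sum_inner_vertices: "(\<Sum>i\<le>d. z \<bullet> x i) = 0"
  by (simp add: sum_vertices flip: inner_sum_right)

lemma span_vertices: "span (x ` {..d}) = UNIV"
proof -
  have "affine hull (x ` {..d}) = UNIV"
    using simplex DIM by (intro affine_independent_span_eq)
      (auto simp: inscribed_regular_simplex_def card_image)
  then show ?thesis using affine_hull_subset_span by blast
qed

text \<open>Both sides are linear in \<open>z\<close> and the vertices span, so it suffices to check
  vertices. There the constant part \<open>- 1 / d\<close> of the inner products drops out because
  the vertices sum to zero.\<close>

lemma frame_identity: "(\<Sum>i\<le>d. (z \<bullet> x i) *\<^sub>R x i) = (1 + 1 / real d) *\<^sub>R z"
proof -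
  let ?T = "\<lambda>z. (\<Sum>i\<le>d. (z \<bullet> x i) *\<^sub>R x i) - (1 + 1 / real d) *\<^sub>R z"
  have "linear ?T"
    by (intro linear_compose_sub linear_compose_sum ballI linear_scaleR)
      (auto intro!: linearI simp: inner_add_left algebra_simps)
  moreover have "?T v = 0" if "v \<in> x ` {..d}" for v
  proof -
    from that obtain j where j: "j \<le> d" "v = x j" by auto
    have "(\<Sum>i\<le>d. (x j \<bullet> x i) *\<^sub>R x i)
        = (\<Sum>i\<le>d. (if i = j then (1 + 1 / real d) *\<^sub>R x i else 0) - (1 / real d) *\<^sub>R x i)"
      using j by (intro sum.cong) (auto simp: inner_vertex scaleR_diff_left)
    also have "\<dots> = (1 + 1 / real d) *\<^sub>R x j"
      using j by (simp add: sum_subtractf sum_vertices flip: scaleR_sum_right)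
    finally show ?thesis using j by simp
  qed
  moreover have "z \<in> span (x ` {..d})" by (simp add: span_vertices)
  ultimately have "?T z = 0" by (rule linear_eq_0_on_span)
  then show ?thesis by simp
qed

lemma sum_inner_vertices_square: "(\<Sum>i\<le>d. (z \<bullet> x i)\<^sup>2) = (1 + 1 / real d) * (norm z)\<^sup>2"
proof -
  have "(\<Sum>i\<le>d. (z \<bullet> x i)\<^sup>2) = (\<Sum>i\<le>d. (z \<bullet> x i) *\<^sub>R x i) \<bullet> z"
    by (simp add: inner_sum_left power2_eq_square inner_commute[of "x _" z])
  then show ?thesis by (simp add: frame_identity power2_norm_eq_inner)
qed

end

section \<open>Half sums of vertices and their inner products\<close>

locale odd_inscribed_simplex = inscribed_simplex +
  assumes d_ge: "d \<ge> 3" and d_odd: "odd d"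
begin

definition half_subsets :: "nat set set" where
  "half_subsets = {I. I \<subseteq> {..d} \<and> card I = (d + 1) div 2}"

definition half_sum :: "nat set \<Rightarrow> 'a" where
  "half_sum I = (2 * sqrt (real d) / (real d + 1)) *\<^sub>R (\<Sum>i\<in>I. x i)"

lemma half_sum_config_eq: "half_sum_config d x = half_sum ` half_subsets"
  by (auto simp: half_sum_config_def half_sum_def half_subsets_def)

lemma real_card_half: "I \<in> half_subsets \<Longrightarrow> real (card I) = (real d + 1) / 2"
  using d_odd by (auto simp: half_subsets_def elim!: oddE)

lemma finite_half: "I \<in> half_subsets \<Longrightarrow> finite I"
  by (auto simp: half_subsets_def intro: finite_subset)

lemma finite_half_subsets: "finite half_subsets"
  by (simp add: half_subsets_def)

text \<open>This provides the exchange of \<open>i\<close> for \<open>j\<close> that compares two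
  half sums. The rest of the subset is chosen among the \<open>d - 1\<close> remaining
  indices.\<close>

lemma half_subset_exists:
  assumes "i \<le> d" "j \<le> d" "i \<noteq> j"
  obtains I where "I \<in> half_subsets" "i \<in> I" "j \<notin> I"
proof -
  have "(d + 1) div 2 - 1 \<le> card ({..d} - {i, j})" using assms d_ge by (simp add: card_Diff_subset)
  then obtain J where J: "J \<subseteq> {..d} - {i, j}" "card J = (d + 1) div 2 - 1" "finite J"
    by (rule obtain_subset_with_card_n)
  then have "insert i J \<in> half_subsets" using assms d_ge by (auto simp: half_subsets_def card_insert_if)
  then show thesis using that[of "insert i J"] J assms by auto
qed

text \<open>As \<open>d\<close> is odd, \<open>(d + 1) div 2\<close> is the exact half of the number
  of vertices.\<close>

lemma complement_half: "I \<in> half_subsets \<Longrightarrow> {..d} - I \<in> half_subsets"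
  using d_odd by (auto simp: half_subsets_def card_Diff_subset finite_subset elim!: oddE)

lemma sum_complement:
  assumes "I \<in> half_subsets"
  shows "(\<Sum>i\<in>{..d} - I. x i) = - (\<Sum>i\<in>I. x i)"
proof -
  have "(\<Sum>i\<in>{..d} - I. x i) = (\<Sum>i\<le>d. x i) - (\<Sum>i\<in>I. x i)"
    using assms by (intro sum_diff) (auto simp: half_subsets_def)
  then show ?thesis by (simp add: sum_vertices)
qed

lemma half_sum_complement: "I \<in> half_subsets \<Longrightarrow> half_sum ({..d} - I) = - half_sum I"
  by (simp add: half_sum_def sum_complement)

text \<open>The constants \<open>- 1 / d\<close> over an exact half add up to
  \<open>- (d + 1) / (2 * d)\<close>, half of the exceptional term \<open>1 + 1 / d\<close> with
  opposite sign; hence the two possible values are opposite.\<close>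

lemma inner_half_sum:
  assumes I: "I \<in> half_subsets" and j: "j \<le> d"
  shows "half_sum I \<bullet> x j = (if j \<in> I then 1 / sqrt (real d) else - 1 / sqrt (real d))"
proof -
  have "(\<Sum>i\<in>I. x i) \<bullet> x j = (\<Sum>i\<in>I. (if i = j then 1 + 1 / real d else 0) - 1 / real d)"
    unfolding inner_sum_left using I j by (intro sum.cong inner_vertex) (auto simp: half_subsets_def)
  also have "\<dots> = (if j \<in> I then 1 + 1 / real d else 0) - (real d + 1) / (2 * real d)"
    using I by (simp add: sum_subtractf finite_half real_card_half)
  also have "\<dots> = (real d + 1) / (2 * real d) * (if j \<in> I then 1 else - 1)"
    using d_pos by (simp add: field_simps)
  finally have "half_sum I \<bullet> x j = sqrt (real d) / real d * (if j \<in> I then 1 else - 1)"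
    using d_pos by (simp add: half_sum_def add_nonneg_eq_0_iff)
  then show ?thesis by (simp add: sqrt_divide_self_eq inverse_eq_divide)
qed

lemma norm_half_sum: "I \<in> half_subsets \<Longrightarrow> norm (half_sum I) = 1"
proof -
  assume I: "I \<in> half_subsets"
  have "(1 + 1 / real d) * (norm (half_sum I))\<^sup>2 = (\<Sum>i\<le>d. 1 / real d)"
    unfolding sum_inner_vertices_square[symmetric] using inner_half_sum[OF I] d_pos
    by (intro sum.cong) (auto simp: power_divide)
  also have "\<dots> = (1 + 1 / real d) * 1" using d_pos by (simp add: field_simps)
  finally have "(norm (half_sum I))\<^sup>2 = 1"
    using d_pos by (subst (asm) mult_left_cancel) (auto simp: field_simps)
  then show ?thesis by (simp add: power2_eq_1_iff) (metis norm_ge_zero not_one_le_zero neg_0_le_iff_le)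
qed

text \<open>The signs of the inner products with the vertices recover the index set.\<close>

lemma inj_on_half_sum: "inj_on half_sum half_subsets"
proof (rule inj_onI)
  fix I J assume IJ: "I \<in> half_subsets" "J \<in> half_subsets" "half_sum I = half_sum J"
  have "j \<in> I \<longleftrightarrow> j \<in> J" if "j \<le> d" for j
    using inner_half_sum[OF IJ(1) that] inner_half_sum[OF IJ(2) that] IJ(3) d_pos
    by (auto split: if_splits)
  then show "I = J" using IJ by (auto simp: half_subsets_def)
qed

section \<open>Symmetry and constant second moments of both configurations\<close>

text \<open>Since the vertices sum to zero, negation corresponds to complementing the index
  set.\<close>

lemma half_sum_config_symmetric: "uminus ` half_sum_config d x = half_sum_config d x"
proof -
  have "uminus ` half_sum ` half_subsets = (\<lambda>I. half_sum ({..d} - I)) ` half_subsets"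
    by (simp add: image_image half_sum_complement)
  also have "\<dots> = half_sum ` half_subsets"
  proof -
    have "(\<lambda>I. {..d} - I) ` half_subsets = half_subsets"
    proof (intro equalityI subsetI)
      fix I assume "I \<in> half_subsets"
      then have "I = {..d} - ({..d} - I)" "{..d} - I \<in> half_subsets"
        using complement_half by (auto simp: half_subsets_def)
      then show "I \<in> (\<lambda>I. {..d} - I) ` half_subsets" by blast
    qed (auto simp: complement_half)
    then show ?thesis by (metis image_image)
  qed
  finally show ?thesis by (simp add: half_sum_config_eq)
qed

text \<open>The numbers \<open>z \<bullet> x i\<close> have sum zero, so
  \<open>sum_subsets_square\<close> reduces the second moment to that of the vertices, which the
  frame identity makes constant on the sphere.\<close>

lemma half_sum_config_design:
  obtains K where "\<And>z. z \<in> sphere 0 1 \<Longrightarrow> (\<Sum>y\<in>half_sum_config d x. (z \<bullet> y)\<^sup>2) = K"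
proof -
  obtain \<gamma> where \<gamma>: "\<And>t :: nat \<Rightarrow> real. (\<Sum>i\<le>d. t i) = 0 \<Longrightarrow>
      (\<Sum>I\<in>half_subsets. (\<Sum>i\<in>I. t i)\<^sup>2) = \<gamma> * (\<Sum>i\<le>d. (t i)\<^sup>2)"
  proof
    show "(\<Sum>I\<in>half_subsets. (\<Sum>i\<in>I. t i)\<^sup>2) = (real ((card {..d} - 1) choose ((d + 1) div 2 - 1))
        - real ((card {..d} - 2) choose ((d + 1) div 2 - 2))) * (\<Sum>i\<le>d. (t i)\<^sup>2)"
      if "(\<Sum>i\<le>d. t i) = 0" for t :: "nat \<Rightarrow> real"
      unfolding half_subsets_def using that d_ge by (intro sum_subsets_square) auto
  qed
  have "(\<Sum>y\<in>half_sum_config d x. (z \<bullet> y)\<^sup>2)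
      = (2 * sqrt (real d) / (real d + 1))\<^sup>2 * (\<gamma> * (1 + 1 / real d))" if "z \<in> sphere 0 1" for z
  proof -
    have "(\<Sum>y\<in>half_sum_config d x. (z \<bullet> y)\<^sup>2)
        = (2 * sqrt (real d) / (real d + 1))\<^sup>2 * (\<Sum>I\<in>half_subsets. (\<Sum>i\<in>I. z \<bullet> x i)\<^sup>2)"
      unfolding half_sum_config_eq sum.reindex[OF inj_on_half_sum] sum_distrib_left
      by (simp add: half_sum_def inner_sum_right power_mult_distrib power_divide)
    then show ?thesis
      using that by (simp add: \<gamma> sum_inner_vertices sum_inner_vertices_square)
  qed
  then show thesis by (rule that)
qed

lemma inj_on_vertices: "inj_on x {..d}"
  using simplex by (simp add: inscribed_regular_simplex_def)

lemma antipodal_config_symmetric: "uminus ` antipodal_config d x = antipodal_config d x"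
  by (auto simp: antipodal_config_def image_Un image_image)

text \<open>The vertices and their negatives are disjoint: \<open>x i = - x j\<close> would give
  inner product -1, but only 1 and \<open>- 1 / d\<close> occur. Each of the two parts contributes
  the frame constant.\<close>

lemma antipodal_config_design:
  assumes "z \<in> sphere 0 1"
  shows "(\<Sum>y\<in>antipodal_config d x. (z \<bullet> y)\<^sup>2) = 2 * (1 + 1 / real d)"
proof -
  have "x i \<noteq> - x j" if "i \<le> d" "j \<le> d" for i j
  proof
    assume "x i = - x j"
    then have "x i \<bullet> x j = - 1" using norm_vertex[OF that(2)] by (simp add: norm_eq_1)
    then show False using that d_ge by (auto simp: inner_vertex field_simps split: if_splits)
  qed
  then have "x ` {..d} \<inter> (\<lambda>i. - x i) ` {..d} = {}" by auto
  moreover have "inj_on (\<lambda>i. - x i) {..d}" using inj_on_vertices by (auto simp: inj_on_def)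
  ultimately show ?thesis using assms
    by (simp add: antipodal_config_def sum.union_disjoint sum.reindex inj_on_vertices sum_inner_vertices_square)
qed

lemma abs_inner_half_sum:
  assumes "z \<in> half_sum_config d x" "y \<in> antipodal_config d x"
  shows "\<bar>z \<bullet> y\<bar> = 1 / sqrt (real d)"
  using assms by (auto simp: half_sum_config_eq antipodal_config_def inner_half_sum)

section \<open>Recovering a point from the absolute values of its inner products\<close>

text \<open>Let \<open>I\<close> collect the indices with positive inner product. The inner products
  sum to zero, so as many are positive as negative, and \<open>I\<close> is a half subset. Then
  \<open>z\<close> and \<open>half_sum I\<close> have the same inner products with all vertices, and
  the frame identity identifies them.\<close>

lemma mem_half_sum_configI:
  assumes z: "\<And>i. i \<le> d \<Longrightarrow> \<bar>z \<bullet> x i\<bar> = 1 / sqrt (real d)"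
  shows "z \<in> half_sum_config d x"
proof -
  define I where "I = {i. i \<le> d \<and> z \<bullet> x i > 0}"
  have fI: "finite I" "I \<subseteq> {..d}" by (auto simp: I_def)
  have zx: "z \<bullet> x i = 1 / sqrt (real d) * (2 * of_bool (i \<in> I) - 1)" if "i \<le> d" for i
    using z[OF that] that d_pos by (auto simp: I_def abs_if split: if_splits)
  have "0 = (\<Sum>i\<le>d. 1 / sqrt (real d) * (2 * of_bool (i \<in> I) - 1))"
    using zx by (simp flip: sum_inner_vertices[of z])
  also have "\<dots> = 1 / sqrt (real d) * (2 * real (card I) - (real d + 1))"
    unfolding sum_distrib_left[symmetric] using fI
    by (simp add: sum_subtractf Int_absorb1 flip: sum_distrib_left)
  finally have "2 * real (card I) = real d + 1" using d_pos by simp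
  then have "2 * card I = d + 1" by linarith
  then have I: "I \<in> half_subsets" using fI by (auto simp: half_subsets_def)
  have "(1 + 1 / real d) *\<^sub>R z = (1 + 1 / real d) *\<^sub>R half_sum I"
    unfolding frame_identity[symmetric] by (intro sum.cong) (auto simp: zx inner_half_sum[OF I])
  moreover have "1 + 1 / real d \<noteq> 0" using d_pos by (simp add: add_nonneg_eq_0_iff)
  ultimately have "z = half_sum I" by simp
  then show ?thesis using I by (simp add: half_sum_config_eq)
qed

text \<open>Exchanging one index of a half subset changes a half sum of the numbers
  \<open>t i\<close> by a difference of two of them. All half sums have the same absolute value,
  which restricts these differences and eventually forces some \<open>t i\<close> to be 1 or
  -1.\<close>

lemma mem_antipodal_configI:
  assumes z: "z \<in> sphere 0 1"
    and eq: "\<And>I. I \<in> half_subsets \<Longrightarrow> \<bar>z \<bullet> half_sum I\<bar> = 1 / sqrt (real d)"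
  shows "z \<in> antipodal_config d x"
proof -
  define t where "t i = z \<bullet> x i" for i
  define D where "D = 1 + 1 / real d"
  have D: "D > 0" using d_pos by (simp add: D_def add_pos_pos)
  have half: "\<bar>\<Sum>i\<in>I. t i\<bar> = D / 2" if "I \<in> half_subsets" for I
  proof -
    have "2 * sqrt (real d) / (real d + 1) * \<bar>\<Sum>i\<in>I. t i\<bar> = 1 / sqrt (real d)"
      using eq[OF that] by (simp add: half_sum_def inner_sum_right abs_mult t_def)
    then have "\<bar>\<Sum>i\<in>I. t i\<bar> = (real d + 1) / (2 * (sqrt (real d) * sqrt (real d)))"
      using d_pos by (simp add: field_simps del: real_sqrt_mult_self)
    then show ?thesis using d_pos by (simp add: D_def field_simps)
  qed
  have diff: "\<bar>t i - t j\<bar> \<in> {0, D}" if ij: "i \<le> d" "j \<le> d" for i j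
  proof (cases "i = j")
    case False
    obtain I where I: "I \<in> half_subsets" "i \<in> I" "j \<notin> I" using half_subset_exists[OF ij False] .
    \<comment> \<open>The half sums over \<open>I\<close> and over this set are both
      \<open>D / 2\<close> up to sign, so they agree or differ by \<open>D\<close>.\<close>
    have J: "insert j (I - {i}) \<in> half_subsets"
      using I ij finite_half[OF I(1)] by (auto simp: half_subsets_def card_insert_if card_Diff_singleton) (metis card_gt_0_iff Suc_pred empty_iff)
    have "(\<Sum>i\<in>insert j (I - {i}). t i) = (\<Sum>i\<in>I. t i) - t i + t j"
      using I finite_half[OF I(1)] by (simp add: sum_diff1)
    then show ?thesis using half[OF I(1)] half[OF J] D by (auto simp: abs_if split: if_splits)
  qed simp
  \<comment> \<open>The numbers \<open>t i\<close> take at most two values, differing by \<open>D\<close>. Their sum and sum of squares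
    force one of the two values to be taken exactly once.\<close>
  define a where "a = Min (t ` {..d})"
  obtain l where l: "l \<le> d" "t l = a" using Min_in[of "t ` {..d}"] by (fastforce simp: a_def)
  have "a \<le> t i" if "i \<le> d" for i using that by (auto simp: a_def)
  then have t_cases: "t i = a \<or> t i = a + D" if "i \<le> d" for i using diff[OF that l(1)] l(2) that by fastforce
  define K where "K = {i. i \<le> d \<and> t i = a + D}"
  define k where "k = real (card K)"
  have K: "finite K" "K \<subseteq> {..d}" by (auto simp: K_def)
  have t_eq: "t i = a + D * of_bool (i \<in> K)" if "i \<le> d" for i
    using t_cases[OF that] that D by (auto simp: K_def)
  have "0 = (\<Sum>i\<le>d. a + D * of_bool (i \<in> K))"
    using t_eq by (simp add: t_def flip: sum_inner_vertices[of z])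
  also have "\<dots> = (real d + 1) * a + D * k"
    using K by (simp add: sum.distrib k_def Int_absorb1 flip: sum_distrib_left)
  finally have "(real d + 1) * (a + k / real d) = 0" using d_pos by (simp add: D_def field_simps)
  then have a: "a = - k / real d" by auto
  \<comment> \<open>The vanishing sum has fixed \<open>a\<close> in terms of \<open>k\<close>; the
    sum of squares, known from the frame identity, now gives a quadratic equation for
    \<open>k\<close> with roots 1 and \<open>d\<close>.\<close>
  have "D = (\<Sum>i\<le>d. (t i)\<^sup>2)"
    using z sum_inner_vertices_square[of z] by (simp add: t_def D_def)
  also have "\<dots> = (\<Sum>i\<le>d. a\<^sup>2 + (2 * a * D + D\<^sup>2) * of_bool (i \<in> K))"
    using t_eq by (intro sum.cong) (auto simp: power2_eq_square algebra_simps)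
  also have "\<dots> = (real d + 1) * a\<^sup>2 + (2 * a * D + D\<^sup>2) * k"
    using K by (simp add: sum.distrib k_def Int_absorb1 flip: sum_distrib_left)
  also have "\<dots> = D * (k * (real d + 1 - k)) / real d"
    using d_pos by (simp add: a D_def field_simps power2_eq_square)
  finally have "D * (k * (real d + 1 - k)) = D * real d" using d_pos by (simp add: field_simps)
  then have "k * (real d + 1 - k) = real d" using D by simp
  then have "(k - 1) * (k - real d) = 0" by (simp add: algebra_simps)
  then have k: "k = 1 \<or> k = real d" by simp
  \<comment> \<open>For \<open>k = 1\<close> the only index in \<open>K\<close> has value
    \<open>a + D = 1\<close>; for \<open>k = d\<close> the minimum \<open>a\<close>, attained at
    \<open>l\<close>, is -1.\<close>
  have "\<exists>i\<le>d. \<bar>z \<bullet> x i\<bar> = 1"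
    using k
  proof
    assume "k = 1"
    then obtain i where "K = {i}" by (auto simp: k_def card_1_singleton_iff)
    then have "i \<le> d" "t i = 1" using K d_pos by (auto simp: t_eq a \<open>k = 1\<close> D_def)
    then show ?thesis by (auto simp: t_def)
  next
    assume "k = real d"
    then have "a = - 1" using d_pos by (simp add: a)
    then show ?thesis using l by (auto simp: t_def)
  qed
  then obtain i where i: "i \<le> d" "z \<bullet> x i = 1 \<or> z \<bullet> x i = - 1" by (auto simp: abs_if split: if_splits)
  \<comment> \<open>This is the equality case of the Cauchy-Schwarz inequality for unit
    vectors.\<close>
  have "z = x i \<or> z = - x i"
    using i(2)
  proof
    assume "z \<bullet> x i = 1"
    then have "(norm (z - x i))\<^sup>2 = 0" using z norm_vertex[OF i(1)]
      by (simp add: power2_norm_eq_inner inner_diff_left inner_diff_right inner_commute norm_eq_1)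
    then show ?thesis by simp
  next
    assume "z \<bullet> x i = - 1"
    then have "(norm (z + x i))\<^sup>2 = 0" using z norm_vertex[OF i(1)]
      by (simp add: power2_norm_eq_inner inner_add_left inner_add_right inner_commute norm_eq_1)
    then show ?thesis by (simp add: eq_neg_iff_add_eq_0)
  qed
  then show ?thesis using i(1) by (auto simp: antipodal_config_def)
qed

end

section \<open>Optimality of each configuration for the potential of the other\<close>

theorem theorem8p5:
  fixes f :: "real \<Rightarrow> ereal"
    and d :: nat
    and x :: "nat \<Rightarrow> real ^ 'n"
  assumes dim: "CARD('n) = d" and "d \<ge> 3" and "odd d"
    and simplex: "inscribed_regular_simplex d x"
    and f_range: "\<forall>t\<in>{0..4}. f t \<noteq> -\<infinity>"
    and f_finite: "\<forall>t\<in>{0<..4}. f t \<noteq> \<infinity>"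
    and f_cont: "continuous_on {0<..4} f"
    and f_zero: "(f \<longlongrightarrow> f 0) (at_right 0)"
    and f_diff: "twice_differentiable_on f {0<..<4}"
    and f_convex: "convex_on {0<..<4} (second_deriv f)"
  shows
    "(\<forall>z\<in>half_sum_config d x. is_arg_min (potential f (antipodal_config d x)) (\<lambda>y. y \<in> sphere 0 1) z) \<and>
     (\<forall>z\<in>antipodal_config d x. is_arg_min (potential f (half_sum_config d x)) (\<lambda>y. y \<in> sphere 0 1) z) \<and>
     (strictly_convex_on {0<..<4} (second_deriv f) \<longrightarrow>
       (\<forall>z. is_arg_min (potential f (antipodal_config d x)) (\<lambda>y. y \<in> sphere 0 1) z \<longrightarrow>
            z \<in> half_sum_config d x) \<and>
       (\<forall>z. is_arg_min (potential f (half_sum_config d x)) (\<lambda>y. y \<in> sphere 0 1) z \<longrightarrow>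
            z \<in> antipodal_config d x))"
proof -
  interpret odd_inscribed_simplex d x
    by unfold_locales (use dim \<open>d \<ge> 3\<close> \<open>odd d\<close> simplex in auto)
  \<comment> \<open>This is the common absolute value of the inner products between the two
    configurations, so one minorant serves both potentials.\<close>
  define c where "c = 1 / sqrt (real d)"
  have c: "0 < c" "c < 1" using d_ge by (auto simp: c_def)
  obtain a b :: real where
    le: "\<And>t. \<bar>t\<bar> \<le> 1 \<Longrightarrow> ereal (a + b * t\<^sup>2) \<le> f (2 - 2 * t) + f (2 + 2 * t)" and
    eq: "\<And>t. \<bar>t\<bar> = c \<Longrightarrow> f (2 - 2 * t) + f (2 + 2 * t) = ereal (a + b * t\<^sup>2)" and
    tight: "\<And>t. \<lbrakk>strictly_convex_on {0<..<4} (second_deriv f); \<bar>t\<bar> \<le> 1;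
           f (2 - 2 * t) + f (2 + 2 * t) = ereal (a + b * t\<^sup>2)\<rbrakk> \<Longrightarrow> \<bar>t\<bar> = c"
    using pair_potential_minorant[OF f_range f_finite f_cont f_zero f_diff f_convex c] by blast
  let ?A = "antipodal_config d x" and ?H = "half_sum_config d x"
  have A: "finite ?A" "?A \<subseteq> sphere 0 1"
    by (auto simp: antipodal_config_def norm_vertex)
  have H: "finite ?H" "?H \<subseteq> sphere 0 1"
    by (auto simp: half_sum_config_eq finite_half_subsets norm_half_sum)
  obtain K where K: "\<And>z. z \<in> sphere 0 1 \<Longrightarrow> (\<Sum>y\<in>?H. (z \<bullet> y)\<^sup>2) = K"
    using half_sum_config_design by blast
  have HA: "\<bar>z \<bullet> y\<bar> = c" "\<bar>y \<bullet> z\<bar> = c" if "z \<in> ?H" "y \<in> ?A" for z y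
    using abs_inner_half_sum[OF that] by (simp_all add: c_def inner_commute)
  \<comment> \<open>The uniqueness claims need a point attaining the bound: \<open>x 0\<close> for
    the potential of \<open>?H\<close> and \<open>h\<close> for that of \<open>?A\<close>.\<close>
  have x0: "x 0 \<in> ?A" by (auto simp: antipodal_config_def)
  obtain I where "I \<in> half_subsets"
    by (rule half_subset_exists[of 0 1]) (use d_ge in auto)
  then obtain h where h: "h \<in> ?H" by (auto simp: half_sum_config_eq)
  show ?thesis
  proof (intro conjI ballI impI allI)
    fix z assume z: "z \<in> ?H"
    show "is_arg_min (potential f ?A) (\<lambda>y. y \<in> sphere 0 1) z"
      by (rule is_arg_min_potential[OF A(1) antipodal_config_symmetric A(2)])
        (fact antipodal_config_design le eq HA(1)[OF z] subsetD[OF H(2) z])+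
  next
    fix z assume z: "z \<in> ?A"
    show "is_arg_min (potential f ?H) (\<lambda>y. y \<in> sphere 0 1) z"
      by (rule is_arg_min_potential[OF H(1) half_sum_config_symmetric H(2)])
        (fact K le eq HA(2)[OF _ z] subsetD[OF A(2) z])+
  next
    fix z assume S: "strictly_convex_on {0<..<4} (second_deriv f)"
      and z: "is_arg_min (potential f ?A) (\<lambda>y. y \<in> sphere 0 1) z"
    have "\<bar>z \<bullet> y\<bar> = c" if "y \<in> ?A" for y
      by (rule is_arg_min_potentialD[OF A(1) antipodal_config_symmetric A(2)])
        (fact antipodal_config_design le eq HA(1)[OF h] subsetD[OF H(2) h] tight[OF S] z that)+
    then show "z \<in> ?H"
      by (intro mem_half_sum_configI) (simp add: antipodal_config_def c_def)
  next
    fix z assume S: "strictly_convex_on {0<..<4} (second_deriv f)"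
      and z: "is_arg_min (potential f ?H) (\<lambda>y. y \<in> sphere 0 1) z"
    have "\<bar>z \<bullet> y\<bar> = c" if "y \<in> ?H" for y
      by (rule is_arg_min_potentialD[OF H(1) half_sum_config_symmetric H(2)])
        (fact K le eq HA(2)[OF _ x0] subsetD[OF A(2) x0] tight[OF S] z that)+
    moreover have "z \<in> sphere 0 1" using z by (simp add: is_arg_min_def)
    ultimately show "z \<in> ?A"
      by (intro mem_antipodal_configI) (simp_all add: half_sum_config_eq c_def)
  qed
qed

end
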